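(* In the differentially-private decentralized algorithm described in the context, at iteration $k$ the noise $n_i^k$ ensures $(\epsilon,\delta)$-differential privacy for agent $i$'s optimization variable $x_i^k$, for any $\epsilon,\delta\in(0,1)$, when the noise variance $\sigma^2$ satisfies $$\sigma^2\ \ge\ 2\,\frac{\ln(1.25/\delta)}{(\lambda^k)^2\,\epsilon^2}.$$
   Context: Setting. There are $m$ agents; agent $i$ has a differentiable local objective $f_i:\mathbb{R}^d\to\mathbb{R}$. $\|\cdot\|_1$ denotes the $\ell^1$ norm. Algorithm. At iteration $k$, with stepsize $\lambda^k>0$, agent $i$ holds a state (optimization variable) $x_i^k\in\mathbb{R}^d$, computes $g_i^k=\nabla f_i(x_i^k)$ and sends to each neighbour $j$ the message $w_{ji}\bigl(x_i^k-\lambda^k(g_i^k+n_i^k)\bigr)$, where the weights $w_{ji}>0$ are publicly known and $n_i^k\in\mathbb{R}^d$ is Gaussian noise with mean zero and variance $\sigma^2$ in each coordinate (covariance $\sigma^2I_d$), so that the noise applied to the shared information is $\lambda^kn_i^k$, of variance $(\lambda^k)^2\sigma^2$. Each agent then updates $x_i^{k+1}=\sum_{j\in\mathbb{N}_i}w_{ij}(x_j^k-\lambda^k(g_j^k+n_j^k))$, where $\mathbb{N}_i=\{j:w_{ij}>0\}$. Differential privacy. A randomized function $h$ is $(\epsilon,\delta)$-differentially private if for all $S\subset\mathrm{Range}(h)$ and all inputs $x,y$ with $\|x-y\|_1\le1$, $\mathrm{Prob}(h(x)\in S)\le e^{\epsilon}\,\mathrm{Prob}(h(y)\in S)+\delta$.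 Privacy of agent $i$'s optimization variable at iteration $k$ refers to the information $x_i^k-\lambda^k(g_i^k+n_i^k)$ shared by agent $i$ (since the $w_{ji}$ are public), viewed as a randomized function of $x_i^k\in\mathbb{R}^d$ with the vector $g_i^k$ held fixed; the compared inputs are $x_i^k,{x'}_i^k$ with $\|x_i^k-{x'}_i^k\|_1\le1$. The noise-free shared quantity is $M_i^k=x_i^k-\lambda^kg_i^k$, and its sensitivity $\sup_{\|x_i^k-{x'}_i^k\|_1\le1}\|M_i^k(x_i^k)-M_i^k({x'}_i^k)\|_1$ equals $1$. *)

theory Defs
  imports "HOL-Probability.Probability"
begin

definition l1_norm :: "real ^ 'd \<Rightarrow> real" where
  "l1_norm x = (\<Sum>c\<in>UNIV. \<bar>x $ c\<bar>)"

definition gradient :: "('a::real_inner \<Rightarrow> real) \<Rightarrow> 'a \<Rightarrow> 'a" where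
  "gradient f x = (THE D. GDERIV f x :> D)"

text \<open>Density of the normal distribution with mean \<open>\<mu>\<close> and (nonsingular) covariance
  matrix \<open>\<Sigma>\<close>.\<close>

definition mvn_density :: "real ^ 'd \<Rightarrow> real ^ 'd ^ 'd \<Rightarrow> real ^ 'd \<Rightarrow> real" where
  "mvn_density \<mu> \<Sigma> x =
     exp (- ((x - \<mu>) \<bullet> (matrix_inv \<Sigma> *v (x - \<mu>))) / 2) / sqrt ((2 * pi) ^ CARD('d) * det \<Sigma>)"

text \<open>A randomized function is a family \<open>h\<close> of random variables on a common probability
  space \<open>M\<close>, indexed by the input. Measurability of each \<open>h x\<close> is part of the notion, since
  \<^const>\<open>measure\<close> is 0 on non-measurable sets. The events are all Borel subsets of the
  output space.\<close>

definition differentially_private ::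
  "'w measure \<Rightarrow> real \<Rightarrow> real \<Rightarrow> (real ^ 'd \<Rightarrow> 'w \<Rightarrow> 'b::topological_space) \<Rightarrow> bool" where
  "differentially_private M \<epsilon> \<delta> h \<longleftrightarrow>
     (\<forall>x. h x \<in> borel_measurable M) \<and>
     (\<forall>S \<in> sets borel. \<forall>x y. l1_norm (x - y) \<le> 1 \<longrightarrow>
        measure M {\<omega> \<in> space M. h x \<omega> \<in> S} \<le> exp \<epsilon> * measure M {\<omega> \<in> space M. h y \<omega> \<in> S} + \<delta>)"

definition neighbours :: "('m \<Rightarrow> 'm \<Rightarrow> real) \<Rightarrow> 'm \<Rightarrow> 'm set" where
  "neighbours w i = {j. w i j > 0}"

text \<open>What an agent with state \<open>x\<close>, gradient \<open>g\<close> and noise \<open>n\<close> discloses, up to the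
  public weights, when the stepsize is \<open>l\<close>.\<close>

definition shared_info :: "real \<Rightarrow> real ^ 'd \<Rightarrow> real ^ 'd \<Rightarrow> real ^ 'd \<Rightarrow> real ^ 'd" where
  "shared_info l g n x = x - l *\<^sub>R (g + n)"

text \<open>The agents are the elements of the finite type \<open>'m\<close>. The states \<open>x k i\<close> are functions on
  the probability space because they depend on the noise of the earlier iterations.\<close>

locale dp_decentralized_algorithm = prob_space M
  for M :: "'w measure" +
  fixes f :: "'m::finite \<Rightarrow> real ^ 'd \<Rightarrow> real"
    and w :: "'m \<Rightarrow> 'm \<Rightarrow> real"
    and stepsize :: "nat \<Rightarrow> real"
    and \<sigma> :: real
    and n :: "nat \<Rightarrow> 'm \<Rightarrow> 'w \<Rightarrow> real ^ 'd"
    and x :: "nat \<Rightarrow> 'm \<Rightarrow> 'w \<Rightarrow> real ^ 'd"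
  assumes objective_differentiable: "f i differentiable (at y)"
    and weight_nonneg: "w i j \<ge> 0"
    and stepsize_pos: "stepsize k > 0"
    and \<sigma>_pos: "\<sigma> > 0"
    and noise_distr: "distributed M lborel (n k i) (\<lambda>z. ennreal (mvn_density 0 (\<sigma>\<^sup>2 *\<^sub>R mat 1) z))"
    and update: "\<omega> \<in> space M \<Longrightarrow>
      x (Suc k) i \<omega> =
        (\<Sum>j\<in>neighbours w i.
           w i j *\<^sub>R shared_info (stepsize k) (gradient (f j) (x k j \<omega>)) (n k j \<omega>) (x k j \<omega>))"

end

theory Submission
  imports Defs
begin

text \<open>
  Shifting the input of the shared information is the same as shifting the noise: after solving for
  the noise, an event for input \<open>y\<close> becomes \<open>N \<in> A\<close>, and the same event for input \<open>y'\<close> becomes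
  \<open>N - v \<in> A\<close>, where \<open>v = (y' - y) / l\<close> and \<open>l\<close> is the stepsize. The Euclidean length of \<open>v\<close> is at
  most \<open>1 / l\<close> because the \<open>\<ell>\<^sup>1\<close> norm dominates the Euclidean one.

  The usual proof bounds the probability that the privacy loss exceeds \<open>\<epsilon>\<close> by a one-dimensional
  Gaussian tail, which requires the law of the projection of the noise onto \<open>v\<close>. The argument below,
  in the spirit of Renyi divergences, uses only the translation invariance of Lebesgue measure.
  If \<open>\<rho>\<close> denotes the noise density and \<open>a \<ge> 1\<close>, the elementary inequality
  \<open>1 - exp (- L) \<le> exp (a * L) / 4\<close>, applied to the excess \<open>L\<close> of the privacy loss over \<open>\<epsilon>\<close>,
  bounds \<open>\<rho> z - exp \<epsilon> * \<rho> (z + v)\<close> by a multiple of \<open>\<rho> z * (\<rho> z / \<rho> (z + v)) powr a\<close>. Completing the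
  square shows that this last function is a constant times \<open>\<rho> (z - a v)\<close>
  (lemma \<open>gaussian_kernel_le\<close>). As \<open>\<rho> (z - a v)\<close> has total integral one, integrating over \<open>A\<close> gives
  \<open>P (N \<in> A) \<le> exp \<epsilon> * P (N - v \<in> A) + D\<close> with
  \<open>D = exp (a * (a + 1) * (norm v)\<^sup>2 / (2 * \<sigma>\<^sup>2) - a * \<epsilon>) / 4\<close> (lemma \<open>gaussian_shift_prob_le\<close>).

  It remains to choose \<open>a\<close> so that \<open>D \<le> \<delta>\<close>. Put \<open>T = (\<epsilon> * \<sigma> * l)\<^sup>2 / 2\<close>. The lower bound on the variance
  says \<open>T \<ge> ln (1.25 / \<delta>)\<close>, so \<open>\<delta> \<ge> 1.25 * exp (- T)\<close>, and it suffices that the exponent in \<open>D\<close> is at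
  most \<open>ln 5 - T\<close>: the constant \<open>1.25\<close> together with the factor \<open>1/4\<close> leaves a slack of \<open>ln 5 > 8/5\<close>.
  Such an \<open>a\<close> exists for all \<open>\<epsilon> < 1\<close> and \<open>T \<ge> 0.21\<close> (lemma \<open>exists_order_exponent_le\<close>), and
  \<open>T \<ge> ln 1.25 > 0.21\<close> because \<open>\<delta> < 1\<close>.
\<close>

section \<open>A pointwise comparison of Gaussian kernels\<close>

text \<open>For \<open>L \<ge> 0\<close> the case \<open>a = 1\<close> is the strongest, and there the claim is the inequality of
  arithmetic and geometric means for \<open>exp L\<close> and \<open>4 * exp (- L)\<close>; equality holds at \<open>L = ln 2\<close>, so
  the factor \<open>1/4\<close> is optimal. For \<open>L < 0\<close> the left-hand side is negative.\<close>

lemma one_minus_exp_neg_le: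
  fixes a L :: real
  assumes "a \<ge> 1"
  shows "1 - exp (- L) \<le> exp (a * L) / 4"
proof (cases "L \<ge> 0")
  case True
  have "0 \<le> (exp (L / 2) - 2 * exp (- L / 2))\<^sup>2"
    by simp
  also have "\<dots> = exp L - 4 + 4 * exp (- L)"
    by (simp add: power2_eq_square algebra_simps flip: exp_add)
  finally have "1 - exp (- L) \<le> exp L / 4"
    by simp
  also have "\<dots> \<le> exp (a * L) / 4"
    using assms True mult_right_mono[of 1 a L] by simp
  finally show ?thesis .
next
  case False
  then have "1 - exp (- L) \<le> 0"
    by simp
  also have "0 \<le> exp (a * L) / 4"
    by simp
  finally show ?thesis .
qed

text \<open>Write \<open>p\<close> for the Gaussian kernel and \<open>q z = p (z + v)\<close>. The last summand is
  \<open>p powr (1 + a) * (exp \<epsilon> * q) powr (- a) / 4\<close>: the exponent of \<open>p powr (1 + a) * q powr (- a)\<close> is a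
  quadratic polynomial in \<open>z\<close> with the same leading part as that of \<open>p\<close>, so completing the square turns it
  into a kernel centred at \<open>a *\<^sub>R v\<close> times a factor that does not depend on \<open>z\<close>.\<close>

lemma gaussian_kernel_le:
  fixes v z :: "'a::real_inner" and a s \<epsilon> :: real
  assumes "a \<ge> 1" and "s \<noteq> 0"
  shows "exp (- (norm z)\<^sup>2 / (2 * s\<^sup>2)) \<le>
    exp \<epsilon> * exp (- (norm (z + v))\<^sup>2 / (2 * s\<^sup>2)) +
    exp (a * (a + 1) * (norm v)\<^sup>2 / (2 * s\<^sup>2) - a * \<epsilon>) / 4 * exp (- (norm (z - a *\<^sub>R v))\<^sup>2 / (2 * s\<^sup>2))"
proof -
  \<comment> \<open>the logarithm of \<open>p z / (exp \<epsilon> * p (z + v))\<close>\<close>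
  define L where "L = ((norm (z + v))\<^sup>2 - (norm z)\<^sup>2) / (2 * s\<^sup>2) - \<epsilon>"
  let ?p = "- (norm z)\<^sup>2 / (2 * s\<^sup>2)"
  have 1: "?p - L = \<epsilon> + - (norm (z + v))\<^sup>2 / (2 * s\<^sup>2)"
    by (simp add: L_def diff_divide_distrib)
  have "a * ((norm (z + v))\<^sup>2 - (norm z)\<^sup>2) - (norm z)\<^sup>2
      = a * (a + 1) * (norm v)\<^sup>2 - (norm (z - a *\<^sub>R v))\<^sup>2"
    unfolding power2_norm_eq_inner by (simp add: inner_simps inner_commute[of v z] algebra_simps)
  then have "(a * ((norm (z + v))\<^sup>2 - (norm z)\<^sup>2) - (norm z)\<^sup>2) / (2 * s\<^sup>2)
      = (a * (a + 1) * (norm v)\<^sup>2 - (norm (z - a *\<^sub>R v))\<^sup>2) / (2 * s\<^sup>2)"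
    by simp
  then have 2: "?p + a * L
      = (a * (a + 1) * (norm v)\<^sup>2 / (2 * s\<^sup>2) - a * \<epsilon>) + - (norm (z - a *\<^sub>R v))\<^sup>2 / (2 * s\<^sup>2)"
    by (simp add: L_def diff_divide_distrib add_divide_distrib algebra_simps)
  have "exp ?p * (1 - exp (- L)) \<le> exp ?p * (exp (a * L) / 4)"
    by (intro mult_left_mono one_minus_exp_neg_le assms) simp
  moreover have "exp (?p - L) = exp ?p * exp (- L)" and "exp (?p + a * L) = exp ?p * exp (a * L)"
    by (simp_all flip: exp_add)
  ultimately have "exp ?p \<le> exp (?p - L) + exp (?p + a * L) / 4"
    by (simp add: right_diff_distrib)
  then show ?thesis
    unfolding 1 2 exp_add by simp
qed

section \<open>Events under a shifted Gaussian\<close>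

lemma nn_integral_lborel_translate:
  fixes F :: "'a::euclidean_space \<Rightarrow> ennreal"
  assumes [measurable]: "F \<in> borel_measurable borel"
  shows "(\<integral>\<^sup>+z. F (z + c) \<partial>lborel) = (\<integral>\<^sup>+z. F z \<partial>lborel)"
proof -
  have "(\<integral>\<^sup>+z. F z \<partial>lborel) = (\<integral>\<^sup>+z. F z \<partial>distr lborel borel ((+) c))"
    by (simp add: lborel_distr_plus)
  also have "\<dots> = (\<integral>\<^sup>+z. F (z + c) \<partial>lborel)"
    by (subst nn_integral_distr) (auto simp: add.commute)
  finally show ?thesis
    by simp
qed

text \<open>The three kernels of \<open>gaussian_kernel_le\<close> are translates of one probability density. Over \<open>A\<close>
  the first two integrate to the two probabilities, and the third contributes at most its total mass
  one. Hence neither the dimension nor the normalizing constant \<open>K\<close> enters the bound.\<close>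

lemma (in prob_space) gaussian_shift_prob_le:
  fixes N :: "'a \<Rightarrow> 'b::euclidean_space" and K s \<epsilon> a :: real
  assumes N: "distributed M lborel N (\<lambda>z. ennreal (K * exp (- (norm z)\<^sup>2 / (2 * s\<^sup>2))))"
    and "K \<ge> 0" and "s \<noteq> 0" and "a \<ge> 1" and A[measurable]: "A \<in> sets borel"
  shows "prob {\<omega> \<in> space M. N \<omega> \<in> A} \<le> exp \<epsilon> * prob {\<omega> \<in> space M. N \<omega> - v \<in> A}
    + exp (a * (a + 1) * (norm v)\<^sup>2 / (2 * s\<^sup>2) - a * \<epsilon>) / 4"
proof -
  define \<rho> where "\<rho> z = K * exp (- (norm z)\<^sup>2 / (2 * s\<^sup>2))" for z :: 'b
  define D where "D = exp (a * (a + 1) * (norm v)\<^sup>2 / (2 * s\<^sup>2) - a * \<epsilon>) / 4"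
  have D: "D \<ge> 0"
    by (simp add: D_def)
  have \<rho>_nonneg: "\<rho> z \<ge> 0" for z
    using \<open>K \<ge> 0\<close> by (simp add: \<rho>_def)
  have [measurable]: "\<rho> \<in> borel_measurable borel"
    unfolding \<rho>_def by measurable
  have N\<rho>: "distributed M lborel N (\<lambda>z. ennreal (\<rho> z))"
    using N by (simp add: \<rho>_def)
  have event: "emeasure M {\<omega> \<in> space M. N \<omega> \<in> B} = (\<integral>\<^sup>+z. ennreal (\<rho> z) * indicator B z \<partial>lborel)"
    if "B \<in> sets borel" for B
    using distributed_emeasure[OF N\<rho>, of B] that
    by (simp add: vimage_def Int_def conj_commute)
  have total: "(\<integral>\<^sup>+z. ennreal (\<rho> z) \<partial>lborel) = 1"
    using event[of UNIV] by (simp add: emeasure_space_1)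
  have kernel: "\<rho> z \<le> exp \<epsilon> * \<rho> (z + v) + D * \<rho> (z - a *\<^sub>R v)" for z
    using mult_left_mono[OF gaussian_kernel_le[OF \<open>a \<ge> 1\<close> \<open>s \<noteq> 0\<close>, of z \<epsilon> v] \<open>K \<ge> 0\<close>]
    by (simp add: \<rho>_def D_def algebra_simps)
  let ?A' = "{z. z - v \<in> A}"
  have [measurable]: "?A' \<in> sets borel"
    by measurable
  have "emeasure M {\<omega> \<in> space M. N \<omega> \<in> A} = (\<integral>\<^sup>+z. ennreal (\<rho> z) * indicator A z \<partial>lborel)"
    by (rule event[OF A])
  also have "\<dots> \<le> (\<integral>\<^sup>+z. ennreal (exp \<epsilon>) * (ennreal (\<rho> (z + v)) * indicator ?A' (z + v))
                      + ennreal D * ennreal (\<rho> (z + - (a *\<^sub>R v))) \<partial>lborel)"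
  proof (rule nn_integral_mono)
    fix z :: 'b
    have "ennreal (\<rho> z) \<le> ennreal (exp \<epsilon>) * ennreal (\<rho> (z + v)) + ennreal D * ennreal (\<rho> (z - a *\<^sub>R v))"
      using kernel[of z] \<rho>_nonneg D by (simp add: ennreal_leI flip: ennreal_mult ennreal_plus)
    then show "ennreal (\<rho> z) * indicator A z \<le>
        ennreal (exp \<epsilon>) * (ennreal (\<rho> (z + v)) * indicator ?A' (z + v))
          + ennreal D * ennreal (\<rho> (z + - (a *\<^sub>R v)))"
      by (auto split: split_indicator)
  qed
  also have "\<dots> = ennreal (exp \<epsilon>) * (\<integral>\<^sup>+z. ennreal (\<rho> (z + v)) * indicator ?A' (z + v) \<partial>lborel)
                    + ennreal D * (\<integral>\<^sup>+z. ennreal (\<rho> (z + - (a *\<^sub>R v))) \<partial>lborel)"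
    by (simp add: nn_integral_add nn_integral_cmult)
  also have "(\<integral>\<^sup>+z. ennreal (\<rho> (z + v)) * indicator ?A' (z + v) \<partial>lborel)
      = (\<integral>\<^sup>+z. ennreal (\<rho> z) * indicator ?A' z \<partial>lborel)"
    by (rule nn_integral_lborel_translate) measurable
  also have "(\<integral>\<^sup>+z. ennreal (\<rho> (z + - (a *\<^sub>R v))) \<partial>lborel) = 1"
    by (subst nn_integral_lborel_translate) (auto simp: total)
  also have "(\<integral>\<^sup>+z. ennreal (\<rho> z) * indicator ?A' z \<partial>lborel) = emeasure M {\<omega> \<in> space M. N \<omega> - v \<in> A}"
    by (subst event[symmetric]) simp_all
  finally have "ennreal (prob {\<omega> \<in> space M. N \<omega> \<in> A})
      \<le> ennreal (exp \<epsilon> * prob {\<omega> \<in> space M. N \<omega> - v \<in> A} + D)"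
    using D by (simp add: emeasure_eq_measure ennreal_mult)
  then have "prob {\<omega> \<in> space M. N \<omega> \<in> A} \<le> exp \<epsilon> * prob {\<omega> \<in> space M. N \<omega> - v \<in> A} + D"
    using D by (subst (asm) ennreal_le_iff) simp_all
  then show ?thesis
    by (simp add: D_def)
qed

section \<open>Choice of the order\<close>

text \<open>With \<open>T = (\<epsilon> * \<sigma> * l)\<^sup>2 / 2\<close> the left-hand side is the exponent \<open>a * (a + 1) / (2 * (\<sigma> * l)\<^sup>2) - a * \<epsilon>\<close>
  of the additive term, a convex quadratic in \<open>a\<close> with minimum at \<open>2 * T / \<epsilon> - 1 / 2\<close>. For
  \<open>T \<ge> 3/4\<close> this minimizer is at least \<open>1\<close> and can be used. For smaller \<open>T\<close> the order \<open>a = 1\<close>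
  suffices: the exponent is then convex in \<open>\<epsilon>\<close>, hence largest at an endpoint of \<open>[0, 1]\<close>, and at
  \<open>\<epsilon> = 1\<close> the claim is a quadratic inequality in \<open>T\<close>. The bound \<open>21/100\<close> is a round value below
  \<open>ln 1.25\<close> for which this inequality still holds.\<close>

lemma exists_order_exponent_le:
  fixes T \<epsilon> :: real
  assumes T: "T \<ge> 21 / 100" and \<epsilon>: "0 < \<epsilon>" "\<epsilon> < 1"
  shows "\<exists>a\<ge>1. a * (a + 1) * (\<epsilon>\<^sup>2 / (4 * T)) - a * \<epsilon> \<le> 8 / 5 - T"
proof (cases "T \<ge> 3 / 4")
  case True
  define a where "a = 2 * T / \<epsilon> - 1 / 2"
  have a: "a \<ge> 1"
    using True \<epsilon> by (simp add: a_def field_simps)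
  have "a * (a + 1) * (\<epsilon>\<^sup>2 / (4 * T)) - a * \<epsilon> = - T + \<epsilon> / 2 - \<epsilon>\<^sup>2 / (16 * T)"
    using True \<epsilon> by (simp add: a_def field_simps power2_eq_square)
  also have "\<dots> \<le> 8 / 5 - T"
  proof -
    have "\<epsilon>\<^sup>2 / (16 * T) \<ge> 0"
      using True by simp
    with \<epsilon> show ?thesis
      by linarith
  qed
  finally show ?thesis
    using a by blast
next
  case False
  \<comment> \<open>For \<open>\<epsilon> = 1\<close> the claim reads \<open>1/2 + T\<^sup>2 \<le> 13/5 * T\<close>; here \<open>T\<^sup>2\<close> lies below its chord over
      \<open>[21/100, 3/4]\<close>.\<close>
  have "(T - 21 / 100) * (T - 3 / 4) \<le> 0"
    using T False by (intro mult_nonneg_nonpos) auto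
  moreover have "(T - 21 / 100) * (T - 3 / 4) = T * T - 24 / 25 * T + 63 / 400"
    by (simp add: field_simps)
  ultimately have "1 / 2 + T * T \<le> 13 / 5 * T"
    using T by linarith
  then have endpoint: "1 / (2 * T) - 1 \<le> 8 / 5 - T"
    using T by (simp add: field_simps)
  have "\<epsilon>\<^sup>2 / (2 * T) - \<epsilon> \<le> \<epsilon> / (2 * T) - \<epsilon>"
    using T \<epsilon> by (simp add: power2_eq_square divide_right_mono mult_left_le)
  also have "\<dots> = \<epsilon> * (1 / (2 * T) - 1)"
    by (simp add: algebra_simps)
  also have "\<dots> \<le> \<epsilon> * (8 / 5 - T)"
    using endpoint \<epsilon> by (intro mult_left_mono) auto
  also have "\<dots> \<le> 8 / 5 - T"
    using False \<epsilon> by (intro mult_left_le_one_le) auto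
  finally show ?thesis
    by (intro exI[of _ 1]) simp
qed

text \<open>The tangent bound \<open>exp x \<ge> 1 + x\<close> is sharp enough only after halving the argument:
  \<open>(1 - 0.105)\<^sup>2 = 0.801025\<close> is at least \<open>4/5\<close>, while \<open>1 - 0.21 = 0.79\<close> is not.\<close>

lemma ln_five_fourths_ge: "ln (5 / 4 :: real) \<ge> 21 / 100"
proof -
  have "exp (- 21 / 200 :: real) \<ge> 179 / 200"
    using exp_ge_add_one_self[of "- 21 / 200 :: real"] by simp
  then have "(exp (- 21 / 200 :: real))\<^sup>2 \<ge> (179 / 200)\<^sup>2"
    by (intro power_mono) auto
  then have "exp (- (21 / 100) :: real) \<ge> 4 / 5"
    by (simp add: power2_eq_square flip: exp_add)
  then have "exp (21 / 100 :: real) \<le> 5 / 4"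
    by (simp add: exp_minus field_simps)
  then show ?thesis
    by (subst ln_ge_iff) simp_all
qed

text \<open>After taking fifth powers this says \<open>exp 1 ^ 8 \<le> 3125\<close>, and \<open>2.72 ^ 8 < 2997\<close>.\<close>

lemma exp_eight_fifths_le: "exp (8 / 5 :: real) \<le> 5"
proof (rule power_le_imp_le_base[where n = 4])
  have "exp (8 / 5 :: real) ^ 5 = exp 1 ^ 8"
    by (simp flip: exp_of_nat_mult)
  also have "\<dots> \<le> (272 / 100) ^ 8"
    using e_less_272 by (intro power_mono) auto
  also have "\<dots> \<le> 5 ^ 5"
    by (simp add: power_divide)
  finally show "exp (8 / 5 :: real) ^ Suc 4 \<le> 5 ^ Suc 4"
    by simp
qed simp

section \<open>Privacy of the shared information\<close>

lemma mvn_density_scaled_identity: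
  fixes z :: "real ^ 'd"
  assumes "s \<noteq> 0"
  shows "mvn_density 0 (s\<^sup>2 *\<^sub>R mat 1) z
    = 1 / sqrt ((2 * pi) ^ CARD('d) * det (s\<^sup>2 *\<^sub>R mat 1 :: real ^ 'd ^ 'd)) * exp (- (norm z)\<^sup>2 / (2 * s\<^sup>2))"
proof -
  have "matrix_inv (s\<^sup>2 *\<^sub>R mat 1 :: real ^ 'd ^ 'd) = (1 / s\<^sup>2) *\<^sub>R mat 1"
    unfolding matrix_inv_def
  proof (rule some_equality)
    show "(s\<^sup>2 *\<^sub>R mat 1) ** ((1 / s\<^sup>2) *\<^sub>R mat 1) = (mat 1 :: real ^ 'd ^ 'd)
      \<and> ((1 / s\<^sup>2) *\<^sub>R mat 1) ** (s\<^sup>2 *\<^sub>R mat 1) = (mat 1 :: real ^ 'd ^ 'd)"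
      using assms by (simp add: matrix_scalar_ac)
  next
    fix B :: "real ^ 'd ^ 'd"
    assume "(s\<^sup>2 *\<^sub>R mat 1) ** B = mat 1 \<and> B ** (s\<^sup>2 *\<^sub>R mat 1) = mat 1"
    then have "s\<^sup>2 *\<^sub>R B = mat 1"
      by (simp flip: scalar_matrix_assoc)
    then show "B = (1 / s\<^sup>2) *\<^sub>R mat 1"
      using assms by (metis divide_inverse_commute mult.right_neutral scaleR_left_imp_eq scaleR_scaleR scaleR_one
          right_inverse power_not_zero)
  qed
  moreover have "((1 / s\<^sup>2) *\<^sub>R mat 1 :: real ^ 'd ^ 'd) *v z = (1 / s\<^sup>2) *\<^sub>R z"
    by (simp add: scaleR_matrix_vector_assoc[symmetric])
  ultimately show ?thesis
    by (simp add: mvn_density_def power2_norm_eq_inner mult.commute)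
qed

lemma norm_le_l1_norm: "norm x \<le> l1_norm x"
  unfolding l1_norm_def by (rule norm_le_l1_cart)

theorem theorem6:
  fixes M :: "'w measure"
    and f :: "'m::finite \<Rightarrow> real ^ 'd \<Rightarrow> real"
    and w :: "'m \<Rightarrow> 'm \<Rightarrow> real"
    and stepsize :: "nat \<Rightarrow> real"
    and \<sigma> \<epsilon> \<delta> :: real
    and n x :: "nat \<Rightarrow> 'm \<Rightarrow> 'w \<Rightarrow> real ^ 'd"
    and k :: nat and i :: 'm and g :: "real ^ 'd" and \<omega>\<^sub>0 :: 'w
  assumes "dp_decentralized_algorithm M f w stepsize \<sigma> n x"
    and "\<epsilon> \<in> {0<..<1}" and "\<delta> \<in> {0<..<1}"
    and "\<sigma>\<^sup>2 \<ge> 2 * (ln (1.25 / \<delta>) / ((stepsize k)\<^sup>2 * \<epsilon>\<^sup>2))"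
    and "\<omega>\<^sub>0 \<in> space M" and "g = gradient (f i) (x k i \<omega>\<^sub>0)"
  shows "differentially_private M \<epsilon> \<delta> (\<lambda>y \<omega>. shared_info (stepsize k) g (n k i \<omega>) y)"
proof -
  interpret dp_decentralized_algorithm M f w stepsize \<sigma> n x
    by fact
  define l where "l = stepsize k"
  define N where "N = n k i"
  define K where "K = 1 / sqrt ((2 * pi) ^ CARD('d) * det (\<sigma>\<^sup>2 *\<^sub>R mat 1 :: real ^ 'd ^ 'd))"
  have l: "l > 0"
    using stepsize_pos by (simp add: l_def)
  have \<epsilon>: "0 < \<epsilon>" "\<epsilon> < 1" and \<delta>: "0 < \<delta>" "\<delta> < 1"
    using assms by auto
  have "det (\<sigma>\<^sup>2 *\<^sub>R mat 1 :: real ^ 'd ^ 'd) \<ge> 0"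
    by (subst det_diagonal) (auto simp: mat_def)
  then have K: "K \<ge> 0"
    by (simp add: K_def)
  have N: "distributed M lborel N (\<lambda>z. ennreal (K * exp (- (norm z)\<^sup>2 / (2 * \<sigma>\<^sup>2))))"
    using noise_distr[of k i] \<sigma>_pos by (simp add: mvn_density_scaled_identity K_def N_def)
  have N_meas[measurable]: "N \<in> borel_measurable M"
    using distributed_measurable[OF N] by simp
  define T where "T = \<epsilon>\<^sup>2 * (\<sigma> * l)\<^sup>2 / 2"
  have T_ge: "T \<ge> ln (1.25 / \<delta>)"
    using assms(4) l \<epsilon> by (simp add: T_def l_def field_simps power_mult_distrib)
  have "ln (5 / 4) \<le> ln (1.25 / \<delta>)"
    using \<delta> by (subst ln_le_cancel_iff) (auto simp: field_simps)
  then have T: "T \<ge> 21 / 100"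
    using T_ge ln_five_fourths_ge by linarith
  obtain a where a: "a \<ge> 1" and exponent: "a * (a + 1) * (\<epsilon>\<^sup>2 / (4 * T)) - a * \<epsilon> \<le> 8 / 5 - T"
    using exists_order_exponent_le[OF T \<epsilon>] by blast
  have order: "\<epsilon>\<^sup>2 / (4 * T) = 1 / l\<^sup>2 / (2 * \<sigma>\<^sup>2)"
    using \<epsilon> l \<sigma>_pos by (simp add: T_def field_simps power_mult_distrib)
  have "exp (8 / 5 - T) = exp (8 / 5) * exp (- T)"
    by (simp flip: exp_add)
  also have "\<dots> \<le> 5 * exp (- ln (1.25 / \<delta>))"
    using T_ge by (intro mult_mono exp_eight_fifths_le) auto
  also have "\<dots> = 4 * \<delta>"
    using \<delta> by (simp add: exp_minus)
  finally have slack: "exp (8 / 5 - T) / 4 \<le> \<delta>"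
    by simp
  show ?thesis
    unfolding differentially_private_def shared_info_def
  proof (intro conjI allI ballI impI)
    show "(\<lambda>\<omega>. y - stepsize k *\<^sub>R (g + n k i \<omega>)) \<in> borel_measurable M" for y
      using N_meas unfolding N_def by measurable
  next
    fix S :: "(real ^ 'd) set" and y y' :: "real ^ 'd"
    assume S[measurable]: "S \<in> sets borel" and "l1_norm (y - y') \<le> 1"
    then have close: "norm (y' - y) \<le> 1"
      using norm_le_l1_norm[of "y - y'"] by (simp add: norm_minus_commute)
    define v where "v = (1 / l) *\<^sub>R (y' - y)"
    define A where "A = {z. y - l *\<^sub>R (g + z) \<in> S}"
    have [measurable]: "A \<in> sets borel"
      unfolding A_def by measurable
    have shift: "z - v \<in> A \<longleftrightarrow> y' - l *\<^sub>R (g + z) \<in> S" for z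
      using l by (simp add: A_def v_def algebra_simps)
    have "norm v \<le> 1 / l"
      using close l by (simp add: v_def divide_right_mono)
    then have "(norm v)\<^sup>2 \<le> 1 / l\<^sup>2"
      using power_mono[of "norm v" "1 / l" 2] by (simp add: power_divide)
    then have "a * (a + 1) * ((norm v)\<^sup>2 / (2 * \<sigma>\<^sup>2)) \<le> a * (a + 1) * (\<epsilon>\<^sup>2 / (4 * T))"
      unfolding order using a by (intro mult_left_mono divide_right_mono) auto
    then have "exp (a * (a + 1) * (norm v)\<^sup>2 / (2 * \<sigma>\<^sup>2) - a * \<epsilon>) / 4 \<le> exp (8 / 5 - T) / 4"
      using exponent by simp
    with slack have "exp (a * (a + 1) * (norm v)\<^sup>2 / (2 * \<sigma>\<^sup>2) - a * \<epsilon>) / 4 \<le> \<delta>"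
      by linarith
    moreover have "prob {\<omega> \<in> space M. N \<omega> \<in> A} \<le> exp \<epsilon> * prob {\<omega> \<in> space M. N \<omega> - v \<in> A}
        + exp (a * (a + 1) * (norm v)\<^sup>2 / (2 * \<sigma>\<^sup>2) - a * \<epsilon>) / 4"
      using \<sigma>_pos by (intro gaussian_shift_prob_le[OF N K _ a]) auto
    ultimately show "prob {\<omega> \<in> space M. y - stepsize k *\<^sub>R (g + n k i \<omega>) \<in> S}
        \<le> exp \<epsilon> * prob {\<omega> \<in> space M. y' - stepsize k *\<^sub>R (g + n k i \<omega>) \<in> S} + \<delta>"
      unfolding shift by (simp add: A_def N_def l_def)
  qed
qed

end
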